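(* Let $\mathcal{X}$ be a set, $N\ge 1$, and let $F_1,\dots,F_N:\mathcal{X}\times[0,1]\times\{0,1\}\to\mathbb{R}$ satisfy, for every $j$ and all $(x,p)\in\mathcal{X}\times[0,1]$, $$p\exp\big(F_j(x,p,1)\big)+(1-p)\exp\big(F_j(x,p,0)\big)\le 1 .$$ Let $T\ge1$, and let $x_1,\dots,x_T\in\mathcal{X}$ and $y_1,\dots,y_T\in\{0,1\}$ be arbitrary ($x_t$ revealed before $p_t$ is chosen, $y_t$ revealed after). Let $p_1,\dots,p_T$ be the predictions of the following $\ell_\infty$ Defensive Forecasting algorithm: at each round $t=1,\dots,T$, set $$Q_{jt}=\sum_{s=1}^{t-1}F_j(x_s,p_s,y_s),\qquad \alpha_{jt}=\frac{\exp(Q_{jt})}{\sum_{i=1}^N\exp(Q_{it})},$$ $$S_t(p)=\sum_{j=1}^N\alpha_{jt}\exp\big(F_j(x_t,p,1)\big)-\sum_{j=1}^N\alpha_{jt}\exp\big(F_j(x_t,p,0)\big),$$ and let $p_t$ be the output of anticorrelation search on $S_t$, where it is assumed that $S_t$ has a root in $[0,1]$ whenever $S_t(1)<0<S_t(0)$ (as is the case when the $F_j$ are continuous in $p$). Then $$\max_{1\le j\le N}\sum_{s=1}^TF_j(x_s,p_s,y_s)\le\log N .$$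
   Context: Anticorrelation search: given a function $S:[0,1]\to\mathbb{R}$, return $p=1$ if $S(1)\ge 0$; otherwise return $p=0$ if $S(0)\le 0$; otherwise return some $p\in[0,1]$ with $S(p)=0$ (exact root finding). Empty sums are $0$, so $\alpha_{j1}=1/N$. *)

theory Defs
  imports Complex_Main
begin

(* "Return some root" is non-deterministic, so the search is a relation between the
   input function and an admissible output; only the values of S on [0,1] are used. *)
definition anticorrelation_search :: "(real \<Rightarrow> real) \<Rightarrow> real \<Rightarrow> bool" where
  "anticorrelation_search S p \<longleftrightarrow>
     (if S 1 \<ge> 0 then p = 1
      else if S 0 \<le> 0 then p = 0
      else p \<in> {0..1} \<and> S p = 0)"

(* Strategies are indexed by 1..N and rounds by 1, 2, ...; outcomes are the naturals 0 and 1.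
   The quantities of round t only use the values of x, p, y at rounds before t
   (and x t in df_S), so the recursion through p is not circular. *)
definition df_Q ::
  "(nat \<Rightarrow> 'a \<Rightarrow> real \<Rightarrow> nat \<Rightarrow> real) \<Rightarrow> (nat \<Rightarrow> 'a) \<Rightarrow> (nat \<Rightarrow> real) \<Rightarrow> (nat \<Rightarrow> nat)
     \<Rightarrow> nat \<Rightarrow> nat \<Rightarrow> real" where
  "df_Q F x p y j t = (\<Sum>s\<in>{1..<t}. F j (x s) (p s) (y s))"

definition df_alpha ::
  "nat \<Rightarrow> (nat \<Rightarrow> 'a \<Rightarrow> real \<Rightarrow> nat \<Rightarrow> real) \<Rightarrow> (nat \<Rightarrow> 'a) \<Rightarrow> (nat \<Rightarrow> real) \<Rightarrow> (nat \<Rightarrow> nat)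
     \<Rightarrow> nat \<Rightarrow> nat \<Rightarrow> real" where
  "df_alpha N F x p y j t = exp (df_Q F x p y j t) / (\<Sum>i=1..N. exp (df_Q F x p y i t))"

definition df_S ::
  "nat \<Rightarrow> (nat \<Rightarrow> 'a \<Rightarrow> real \<Rightarrow> nat \<Rightarrow> real) \<Rightarrow> (nat \<Rightarrow> 'a) \<Rightarrow> (nat \<Rightarrow> real) \<Rightarrow> (nat \<Rightarrow> nat)
     \<Rightarrow> nat \<Rightarrow> real \<Rightarrow> real" where
  "df_S N F x p y t q =
     (\<Sum>j=1..N. df_alpha N F x p y j t * exp (F j (x t) q 1))
     - (\<Sum>j=1..N. df_alpha N F x p y j t * exp (F j (x t) q 0))"

definition linf_defensive_forecasting ::
  "nat \<Rightarrow> (nat \<Rightarrow> 'a \<Rightarrow> real \<Rightarrow> nat \<Rightarrow> real) \<Rightarrow> nat \<Rightarrow> (nat \<Rightarrow> 'a) \<Rightarrow> (nat \<Rightarrow> nat) \<Rightarrow> (nat \<Rightarrow> real)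
     \<Rightarrow> bool" where
  "linf_defensive_forecasting N F T x y p \<longleftrightarrow>
     (\<forall>t\<in>{1..T}. anticorrelation_search (df_S N F x p y t) (p t))"

end

theory Submission
  imports Defs
begin

text \<open>
  The potential \<open>\<Sum>j. exp (Q\<^sub>j\<^sub>t)\<close> starts at \<open>N\<close> and never increases. Its growth factor in round
  \<open>t\<close> is \<open>A y\<^sub>t\<close>, where \<open>A b\<close> is the \<open>\<alpha>\<close>-average of the numbers \<open>exp (F\<^sub>j (x\<^sub>t, p\<^sub>t, b))\<close>.
  Averaging the hypothesis gives \<open>p\<^sub>t A 1 + (1 - p\<^sub>t) A 0 \<le> 1\<close>, and anticorrelation search on
  \<open>S\<^sub>t = A 1 - A 0\<close> turns this bound on the mean into a bound on both \<open>A 0\<close> and \<open>A 1\<close>.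
\<close>

lemma anticorrelation_search_range:
  assumes "anticorrelation_search S p"
  shows "p \<in> {0..1}"
  using assms by (auto simp: anticorrelation_search_def split: if_splits)

text \<open>At an endpoint the mean is a single value, \<open>A 1 1\<close> or \<open>A 0 0\<close>,
  and the sign of the difference there puts the other value below it. At a root both values
  coincide, so each equals the mean. Both \<open>b\<close> are covered because the outcome is
  revealed only after the prediction.\<close>

lemma anticorrelation_search_bounds:
  fixes A :: "nat \<Rightarrow> real \<Rightarrow> real"
  assumes search: "anticorrelation_search (\<lambda>q. A 1 q - A 0 q) p"
    and mean: "p * A 1 p + (1 - p) * A 0 p \<le> 1"
    and b: "b \<in> {0, 1}"
  shows "A b p \<le> 1"
proof -
  consider "p = 1" "A 1 1 \<ge> A 0 1" | "p = 0" "A 1 0 \<le> A 0 0" | "A 1 p = A 0 p"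
    using search by (auto simp: anticorrelation_search_def split: if_splits)
  then show ?thesis
    using mean b by cases (auto simp: algebra_simps)
qed

lemma df_Q_Suc:
  assumes "t \<ge> 1"
  shows "df_Q F x p y j (Suc t) = df_Q F x p y j t + F j (x t) (p t) (y t)"
  using assms by (simp add: df_Q_def)

lemma sum_exp_df_Q_pos:
  assumes "N \<ge> 1"
  shows "(\<Sum>i=1..N. exp (df_Q F x p y i t)) > 0"
  using assms by (intro sum_pos) auto

lemma sum_df_alpha:
  assumes "N \<ge> 1"
  shows "(\<Sum>j=1..N. df_alpha N F x p y j t) = 1"
  using sum_exp_df_Q_pos[OF assms, of F x p y t]
  by (simp add: df_alpha_def sum_divide_distrib [symmetric])

lemma df_alpha_nonneg: "df_alpha N F x p y j t \<ge> 0"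
  by (simp add: df_alpha_def sum_nonneg)

lemma linf_defensive_forecasting_average_le:
  assumes N: "N \<ge> 1"
    and mean: "\<And>j q. \<lbrakk>j \<in> {1..N}; q \<in> {0..1}\<rbrakk> \<Longrightarrow>
           q * exp (F j (x t) q 1) + (1 - q) * exp (F j (x t) q 0) \<le> 1"
    and search: "anticorrelation_search (df_S N F x p y t) (p t)"
    and b: "b \<in> {0, 1}"
  shows "(\<Sum>j=1..N. df_alpha N F x p y j t * exp (F j (x t) (p t) b)) \<le> 1"
proof -
  define a where "a j = df_alpha N F x p y j t" for j
  define A where "A c q = (\<Sum>j=1..N. a j * exp (F j (x t) q c))" for c :: nat and q
  have S: "anticorrelation_search (\<lambda>q. A 1 q - A 0 q) (p t)"
    using search by (simp add: df_S_def [abs_def] A_def a_def)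
  have "p t * A 1 (p t) + (1 - p t) * A 0 (p t)
      = (\<Sum>j=1..N. a j * (p t * exp (F j (x t) (p t) 1) + (1 - p t) * exp (F j (x t) (p t) 0)))"
    by (simp add: A_def sum_distrib_left sum.distrib sum_subtractf algebra_simps)
  \<comment> \<open>The search output lies in [0,1], so \<open>mean\<close> applies at
    \<open>q = p t\<close>; nonnegative weights preserve the inequality.\<close>
  also have "\<dots> \<le> (\<Sum>j=1..N. a j * 1)"
    by (intro sum_mono mult_left_mono mean anticorrelation_search_range[OF S])
      (auto simp: a_def df_alpha_nonneg)
  also have "\<dots> = 1"
    using sum_df_alpha[OF N, of F x p y t] by (simp add: a_def)
  finally have "A b (p t) \<le> 1"
    using anticorrelation_search_bounds[OF S _ b] by simp
  then show ?thesis by (simp add: A_def a_def)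
qed

text \<open>The positive normaliser of \<open>df_alpha\<close> cancels against the first factor,
  leaving \<open>exp (df_Q F x p y j t)\<close> times the exponential of the new increment.\<close>

lemma sum_exp_df_Q_Suc:
  assumes "N \<ge> 1" "t \<ge> 1"
  shows "(\<Sum>j=1..N. exp (df_Q F x p y j (Suc t)))
    = (\<Sum>i=1..N. exp (df_Q F x p y i t))
      * (\<Sum>j=1..N. df_alpha N F x p y j t * exp (F j (x t) (p t) (y t)))"
  using sum_exp_df_Q_pos[OF assms(1), of F x p y t] assms(2)
  by (simp add: df_alpha_def df_Q_Suc exp_add sum_distrib_left)

theorem proposition9p2:
  fixes X :: "'a set"
    and N T :: nat
    and F :: "nat \<Rightarrow> 'a \<Rightarrow> real \<Rightarrow> nat \<Rightarrow> real"
    and x :: "nat \<Rightarrow> 'a"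
    and y :: "nat \<Rightarrow> nat"
    and p :: "nat \<Rightarrow> real"
  assumes "N \<ge> 1"
    and "\<And>j x' q. \<lbrakk>j \<in> {1..N}; x' \<in> X; q \<in> {0..1}\<rbrakk> \<Longrightarrow>
           q * exp (F j x' q 1) + (1 - q) * exp (F j x' q 0) \<le> 1"
    and "T \<ge> 1"
    and "\<And>t. t \<in> {1..T} \<Longrightarrow> x t \<in> X"
    and "\<And>t. t \<in> {1..T} \<Longrightarrow> y t \<in> {0, 1}"
    and "linf_defensive_forecasting N F T x y p"
    and "\<And>t. \<lbrakk>t \<in> {1..T}; df_S N F x p y t 1 < 0; 0 < df_S N F x p y t 0\<rbrakk> \<Longrightarrow>
           \<exists>q\<in>{0..1}. df_S N F x p y t q = 0"
  shows "Max ((\<lambda>j. \<Sum>s=1..T. F j (x s) (p s) (y s)) ` {1..N}) \<le> ln (real N)"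
proof -
  have search: "anticorrelation_search (df_S N F x p y t) (p t)" if "t \<in> {1..T}" for t
    using assms(6) that by (simp add: linf_defensive_forecasting_def)
  \<comment> \<open>\<open>df_Q\<close> at \<open>Suc t\<close> covers exactly rounds 1 to
    \<open>t\<close>. The induction therefore starts from empty sums, where each of the
    \<open>N\<close> exponentials is 1.\<close>
  have potential: "(\<Sum>j=1..N. exp (df_Q F x p y j (Suc t))) \<le> real N" if "t \<le> T" for t
    using that
  proof (induction t)
    case 0
    show ?case by (simp add: df_Q_def)
  next
    case (Suc t)
    then have t: "Suc t \<in> {1..T}" by simp
    let ?A = "\<Sum>j=1..N. df_alpha N F x p y j (Suc t) * exp (F j (x (Suc t)) (p (Suc t)) (y (Suc t)))"
    have "?A \<le> 1"
      using assms(1,2) assms(4,5)[OF t] search[OF t]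
      by (intro linf_defensive_forecasting_average_le) auto
    then have "(\<Sum>i=1..N. exp (df_Q F x p y i (Suc t))) * ?A
        \<le> (\<Sum>i=1..N. exp (df_Q F x p y i (Suc t)))"
      by (intro mult_left_le) (auto intro: sum_nonneg simp: df_alpha_nonneg)
    then show ?case
      using Suc sum_exp_df_Q_Suc[OF assms(1), of "Suc t" F x p y] by simp
  qed
  have "(\<Sum>s=1..T. F j (x s) (p s) (y s)) \<le> ln (real N)" if j: "j \<in> {1..N}" for j
  proof -
    \<comment> \<open>All summands are positive, so the potential dominates each strategy's own
      term; the logarithm then gives the bound.\<close>
    have "exp (df_Q F x p y j (Suc T)) \<le> (\<Sum>i=1..N. exp (df_Q F x p y i (Suc T)))"
      using j by (intro member_le_sum) auto
    then have "exp (df_Q F x p y j (Suc T)) \<le> real N"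
      using potential[of T] by simp
    then have "df_Q F x p y j (Suc T) \<le> ln (real N)"
      using assms(1) by (simp add: ln_ge_iff)
    then show ?thesis
      by (simp add: df_Q_def atLeastLessThanSuc_atLeastAtMost)
  qed
  then show ?thesis
    using assms(1) by auto
qed

end
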